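(* Let $\mathcal{L}:\sum_{i\in[k]}c_ix_i=0$ with $k\ge3$ and $c_1,\dots,c_k\in\mathbb{Z}\setminus\{0\}$ be non-degenerate, i.e. $\sum_{s\in S}c_s\ne0$ for every non-empty $S\subseteq[k]$. Then there exist $\beta>0$, $p_0>0$ and $C>0$ (depending on $\mathcal{L}$) such that for every prime $p>p_0$ there is a solution-free set $A\subseteq\mathbb{F}_p$ of $\mathcal{L}$ with $|A|\ge\beta p$ and $\alpha(\mathrm{Cay}_{\mathbb{F}_p}(A))\le C\frac{p}{\log p}$. In particular, $d(\mathcal{L},\varepsilon)\ge\beta>0$ for all $\varepsilon>0$.
   Context: For a prime $p$, a set $A\subseteq\mathbb{F}_p$ is solution-free for $\mathcal{L}$ if there is no $k$-tuple of pairwise distinct elements $a_1,\dots,a_k\in A$ with $\sum_i c_ia_i=0$ in $\mathbb{F}_p$. The Cayley graph $\mathrm{Cay}_{\mathbb{F}_p}(A)$ is the digraph on $\mathbb{F}_p$ with an arc $\vec{uv}$ iff $v-u\in A$; $\alpha$ of a digraph is the independence number of its underlying undirected graph. $D(\mathcal{L},\varepsilon,p)$ is the maximum size of a solution-free set $A$ of $\mathcal{L}$ in $\mathbb{F}_p$ with $\alpha(\mathrm{Cay}_{\mathbb{F}_p}(A))\le\varepsilon p$, and $d(\mathcal{L},\varepsilon):=\limsup_{p\to\infty,\ p\text{ prime}} D(\mathcal{L},\varepsilon,p)/p$. *)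

theory Defs
  imports
    Complex_Main
    "HOL-Library.Extended_Real"
    "HOL-Number_Theory.Residues"
    "Graph_Theory.Graph_Theory"
begin

(* The equation c_1 x_1 + ... + c_k x_k = 0 is given by k and c; only c 1, ..., c k matter. *)

definition nondegenerate :: "nat \<Rightarrow> (nat \<Rightarrow> int) \<Rightarrow> bool" where
  "nondegenerate k c \<longleftrightarrow> (\<forall>S. S \<subseteq> {1..k} \<and> S \<noteq> {} \<longrightarrow> (\<Sum>s\<in>S. c s) \<noteq> 0)"

(* F_p is the library's ring of residues modulo p, with carrier {0..p-1}. An equation between
   elements of F_p is the corresponding congruence between their representatives. *)

abbreviation Fp :: "nat \<Rightarrow> int ring" where
  "Fp p \<equiv> residue_ring (int p)"

definition solution_free :: "nat \<Rightarrow> (nat \<Rightarrow> int) \<Rightarrow> nat \<Rightarrow> int set \<Rightarrow> bool" where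
  "solution_free k c p A \<longleftrightarrow>
     (\<nexists>a :: nat \<Rightarrow> int. (\<forall>i\<in>{1..k}. a i \<in> A) \<and> inj_on a {1..k} \<and>
        [(\<Sum>i\<in>{1..k}. c i * a i) = 0] (mod int p))"

definition Cay :: "nat \<Rightarrow> int set \<Rightarrow> int pair_pre_digraph" where
  "Cay p A = \<lparr> pverts = carrier (Fp p),
     parcs = {(u, v). u \<in> carrier (Fp p) \<and> v \<in> carrier (Fp p) \<and> v \<ominus>\<^bsub>Fp p\<^esub> u \<in> A} \<rparr>"

(* Loops are ignored: the underlying undirected graph is taken to be simple. Otherwise
   0 \<in> A would leave the empty set as the only independent set of Cay p A. *)

definition independent_in :: "('a, 'b) pre_digraph \<Rightarrow> 'a set \<Rightarrow> bool" where
  "independent_in G S \<longleftrightarrow> S \<subseteq> verts G \<and>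
     (\<forall>u\<in>S. \<forall>v\<in>S. u \<noteq> v \<longrightarrow> \<not> u \<rightarrow>\<^bsub>with_proj (mk_symmetric G)\<^esub> v)"

definition independence_number :: "('a, 'b) pre_digraph \<Rightarrow> nat" where
  "independence_number G = Max {card S |S. independent_in G S}"

abbreviation alpha_Cay :: "nat \<Rightarrow> int set \<Rightarrow> nat" where
  "alpha_Cay p A \<equiv> independence_number (with_proj (Cay p A))"

(* Sup on nat is the maximum of a non-empty finite set and 0 for the empty set,
   so D is 0 when there is no admissible A. *)

definition D :: "nat \<Rightarrow> (nat \<Rightarrow> int) \<Rightarrow> real \<Rightarrow> nat \<Rightarrow> nat" where
  "D k c \<epsilon> p = Sup {card A |A. A \<subseteq> carrier (Fp p) \<and> solution_free k c p A \<and>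
     real (alpha_Cay p A) \<le> \<epsilon> * real p}"

definition d :: "nat \<Rightarrow> (nat \<Rightarrow> int) \<Rightarrow> real \<Rightarrow> ereal" where
  "d k c \<epsilon> = Limsup (inf at_top (principal {p :: nat. prime p}))
     (\<lambda>p. ereal (real (D k c \<epsilon> p) / real p))"

end

theory Submission
  imports Defs
begin

text \<open>
  Let \<open>K = \<Sum>|c\<^sub>i|\<close>, \<open>M = K + 1\<close> and \<open>N = p div (4K\<^sup>2)\<close>. The set \<open>A\<close> is the union of the interval
  \<open>[2KN, 2KN + N]\<close>, which gives the density, and of the few differences \<open>M\<^sup>j - M\<^sup>i\<close> with
  \<open>i < j \<le> n\<close>, where \<open>M\<^sup>n \<le> N\<close>. These differences make \<open>1, M, \<dots>, M\<^sup>n\<close> a clique of the Cayley graph,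
  and in a vertex-transitive graph a clique of size \<open>n + 1\<close> forces \<open>\<alpha> \<le> p / (n + 1)\<close>; here
  \<open>n\<close> is of order \<open>log p\<close>. All elements of \<open>A\<close> are so small that a solution modulo \<open>p\<close> is a solution in
  the integers. There the terms of the largest order of magnitude contribute that order times a
  nonempty subsum of the coefficients, which is nonzero, and the remaining terms cannot cancel it.
\<close>

section \<open>Sums with a dominant order of magnitude\<close>

text \<open>A nonzero integer has absolute value at least 1, so the indices in \<open>T\<close>
  contribute at least \<open>W\<close> in absolute value, while all errors together contribute at
  most \<open>(\<Sum>l\<in>I. \<bar>c l\<bar>) * E\<close>, which is less than
  \<open>W\<close>.\<close>

lemma dominant_part_nonzero:
  fixes c x e :: "'a \<Rightarrow> int"
  assumes "finite I" "T \<subseteq> I" "sum c T \<noteq> 0"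
    and x: "\<And>l. l \<in> I \<Longrightarrow> x l = (if l \<in> T then W else 0) + e l"
    and e: "\<And>l. l \<in> I \<Longrightarrow> \<bar>e l\<bar> \<le> E"
    and W: "(\<Sum>l\<in>I. \<bar>c l\<bar>) * E < W"
  shows "(\<Sum>l\<in>I. c l * x l) \<noteq> 0"
proof -
  have "(\<Sum>l\<in>I. c l * x l) = (\<Sum>l\<in>I. (if l \<in> T then c l * W else 0) + c l * e l)"
    by (rule sum.cong) (auto simp: x algebra_simps)
  also have "\<dots> = (\<Sum>l\<in>I. if l \<in> T then c l * W else 0) + (\<Sum>l\<in>I. c l * e l)"
    by (simp add: sum.distrib)
  also have "(\<Sum>l\<in>I. if l \<in> T then c l * W else 0) = (\<Sum>l\<in>T. c l * W)"
    using assms(1,2) by (simp add: sum.If_cases Int_absorb1)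
  finally have eq: "(\<Sum>l\<in>I. c l * x l) = sum c T * W + (\<Sum>l\<in>I. c l * e l)"
    by (simp add: sum_distrib_right)
  have "\<bar>\<Sum>l\<in>I. c l * e l\<bar> \<le> (\<Sum>l\<in>I. \<bar>c l * e l\<bar>)"
    by (rule sum_abs)
  also have "\<dots> \<le> (\<Sum>l\<in>I. \<bar>c l\<bar> * E)"
    by (intro sum_mono) (auto simp: abs_mult intro!: mult_left_mono e)
  finally have less: "\<bar>\<Sum>l\<in>I. c l * e l\<bar> < W"
    using W by (simp add: sum_distrib_right)
  then have "1 * \<bar>W\<bar> \<le> \<bar>sum c T\<bar> * \<bar>W\<bar>"
    using assms(3) by (intro mult_right_mono) auto
  then have "W \<le> \<bar>sum c T * W\<bar>"
    by (simp add: abs_mult)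
  with less eq show ?thesis
    by linarith
qed

section \<open>The set and its solution-freeness\<close>

definition power_differences :: "int \<Rightarrow> nat \<Rightarrow> int set" where
  "power_differences M n = {M ^ j - M ^ i |i j. i < j \<and> j \<le> n}"

text \<open>The offset \<open>2 * K * N\<close> exceeds \<open>K * N\<close>, the most that
  coefficients of total size \<open>K\<close> can make of errors of size at most
  \<open>N\<close>.\<close>

definition interval_part :: "int \<Rightarrow> int \<Rightarrow> int set" where
  "interval_part K N = {2 * K * N..2 * K * N + N}"

lemma power_differences_bounds:
  assumes "1 < M" "x \<in> power_differences M n"
  shows "0 < x" "x \<le> M ^ n"
proof -
  from assms(2) obtain i j where x: "x = M ^ j - M ^ i" "i < j" "j \<le> n"
    by (auto simp: power_differences_def)
  have "M ^ i < M ^ j" "M ^ j \<le> M ^ n" "0 < M ^ i"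
    using assms(1) x by (auto intro: power_strict_increasing power_increasing)
  with x show "0 < x" "x \<le> M ^ n"
    by auto
qed

text \<open>The terms whose larger exponent is the maximal one, \<open>J\<close>, dominate with
  order \<open>M ^ J\<close>. What remains of each term is at most \<open>M ^ (J - 1)\<close>, and
  the coefficients have total size below \<open>M\<close>.\<close>

lemma power_differences_sum_nonzero:
  fixes c x :: "'a \<Rightarrow> int"
  assumes "finite I" "I \<noteq> {}"
    and nondeg: "\<And>T. T \<subseteq> I \<Longrightarrow> T \<noteq> {} \<Longrightarrow> sum c T \<noteq> 0"
    and M: "1 < M" "(\<Sum>l\<in>I. \<bar>c l\<bar>) < M"
    and x: "\<And>l. l \<in> I \<Longrightarrow> x l \<in> power_differences M n"
  shows "(\<Sum>l\<in>I. c l * x l) \<noteq> 0"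
proof -
  have "\<forall>l\<in>I. \<exists>i j. x l = M ^ j - M ^ i \<and> i < j"
    using x unfolding power_differences_def by blast
  then obtain i j where ij: "\<And>l. l \<in> I \<Longrightarrow> x l = M ^ j l - M ^ i l" "\<And>l. l \<in> I \<Longrightarrow> i l < j l"
    by metis
  define J where "J = Max (j ` I)"
  have le_J: "j l \<le> J" if "l \<in> I" for l
    using that assms(1) by (auto simp: J_def)
  have "J \<in> j ` I"
    using assms(1,2) unfolding J_def by (intro Max_in) auto
  then obtain m where m: "m \<in> I" "j m = J"
    by auto
  with ij(2) have "0 < J"
    by fastforce
  define T where "T = {l \<in> I. j l = J}"
  have "sum c T \<noteq> 0"
    using m by (intro nondeg) (auto simp: T_def)
  \<comment> \<open>On \<open>T\<close> the error is \<open>- (M ^ i l)\<close> with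
    \<open>i l < J\<close>. Off \<open>T\<close> it is \<open>x l\<close> itself, which lies between
    0 and \<open>M ^ j l\<close> with \<open>j l < J\<close>.\<close>
  moreover have "\<bar>x l - (if l \<in> T then M ^ J else 0)\<bar> \<le> M ^ (J - 1)" if l: "l \<in> I" for l
  proof -
    have mono: "M ^ a \<le> M ^ (J - 1)" if "a < J" for a
      using that M by (intro power_increasing) auto
    have pos: "0 < M ^ a" for a
      using M by simp
    have "M ^ i l \<le> M ^ (J - 1)"
      using ij(2)[OF l] le_J[OF l] by (intro mono) simp
    moreover have "M ^ j l \<le> M ^ (J - 1)" if "l \<notin> T"
      using that l le_J[OF l] by (intro mono) (auto simp: T_def)
    ultimately show ?thesis
      using pos[of "i l"] pos[of "j l"] ij(1)[OF l] l by (auto simp: T_def abs_le_iff)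
  qed
  moreover have "(\<Sum>l\<in>I. \<bar>c l\<bar>) * M ^ (J - 1) < M ^ J"
  proof -
    have "(\<Sum>l\<in>I. \<bar>c l\<bar>) * M ^ (J - 1) < M * M ^ (J - 1)"
      using M by (intro mult_strict_right_mono) auto
    also have "\<dots> = M ^ J"
      using \<open>0 < J\<close> by (cases J) auto
    finally show ?thesis .
  qed
  moreover have "T \<subseteq> I"
    by (auto simp: T_def)
  ultimately show ?thesis
    using assms(1)
    by (intro dominant_part_nonzero[where T = T and W = "M ^ J" and E = "M ^ (J - 1)"
          and e = "\<lambda>l. x l - (if l \<in> T then M ^ J else 0)"]) auto
qed

text \<open>If some variable lies in the interval, those variables dominate with order
  \<open>2 * K * N\<close>: positions within the interval and power differences are both errors of
  size at most \<open>N\<close>. Otherwise all variables are power differences. The bound on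
  \<open>p\<close> rules out wrap-around.\<close>

lemma solution_free_interval_power_differences:
  assumes "1 \<le> k" and nondeg: "nondegenerate k c"
    and K: "K = (\<Sum>i\<in>{1..k}. \<bar>c i\<bar>)" and "0 < K" "0 < N"
    and p: "4 * K\<^sup>2 * N \<le> int p" and N: "(K + 1) ^ n \<le> N"
  shows "solution_free k c p (interval_part K N \<union> power_differences (K + 1) n)"
  unfolding solution_free_def
proof (intro notI, elim exE conjE)
  fix a :: "nat \<Rightarrow> int"
  assume a: "\<forall>i\<in>{1..k}. a i \<in> interval_part K N \<union> power_differences (K + 1) n"
    and cong: "[(\<Sum>i\<in>{1..k}. c i * a i) = 0] (mod int p)"
  have nondeg': "sum c T \<noteq> 0" if "T \<subseteq> {1..k}" "T \<noteq> {}" for T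
    using that nondeg by (auto simp: nondegenerate_def)
  define T where "T = {i \<in> {1..k}. a i \<in> interval_part K N}"
  have small: "0 < a i \<and> a i \<le> N" if "a i \<in> power_differences (K + 1) n" for i
    using power_differences_bounds[OF _ that] \<open>0 < K\<close> N by auto
  have KN: "0 < K * N"
    using \<open>0 < K\<close> \<open>0 < N\<close> by simp
  have "(\<Sum>i\<in>{1..k}. c i * a i) \<noteq> 0"
  proof (cases "T = {}")
    case True
    then show ?thesis
      using a \<open>1 \<le> k\<close> \<open>0 < K\<close> K
      by (intro power_differences_sum_nonzero[of _ _ "K + 1" _ n] nondeg') (auto simp: T_def)
  next
    case False
    have "\<bar>a i - (if i \<in> T then 2 * K * N else 0)\<bar> \<le> N" if "i \<in> {1..k}" for i
      using that a small[of i] by (auto simp: T_def interval_part_def)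
    moreover have "(\<Sum>i\<in>{1..k}. \<bar>c i\<bar>) * N < 2 * K * N"
      unfolding K[symmetric] using KN by linarith
    moreover have "T \<subseteq> {1..k}"
      by (auto simp: T_def)
    ultimately show ?thesis
      using False
      by (intro dominant_part_nonzero[where T = T and W = "2 * K * N" and E = N
            and e = "\<lambda>i. a i - (if i \<in> T then 2 * K * N else 0)"] nondeg')
        auto
  qed
  \<comment> \<open>A multiple of \<open>p\<close> of absolute value below \<open>p\<close> is 0, so
    the congruence would be an equation in the integers.\<close>
  moreover have "\<bar>\<Sum>i\<in>{1..k}. c i * a i\<bar> < int p"
  proof -
    have "\<bar>a i\<bar> \<le> 2 * K * N + N" if "i \<in> {1..k}" for i
    proof (cases "a i \<in> interval_part K N")
      case True
      then show ?thesis
        using KN \<open>0 < N\<close> by (auto simp: interval_part_def)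
    next
      case False
      then show ?thesis
        using that a small[of i] KN by auto
    qed
    then have "(\<Sum>i\<in>{1..k}. \<bar>c i * a i\<bar>) \<le> (\<Sum>i\<in>{1..k}. \<bar>c i\<bar> * (2 * K * N + N))"
      by (intro sum_mono) (auto simp: abs_mult intro!: mult_left_mono)
    then have "\<bar>\<Sum>i\<in>{1..k}. c i * a i\<bar> \<le> K * (2 * K * N + N)"
      using sum_abs[of "\<lambda>i. c i * a i" "{1..k}"]
      unfolding K sum_distrib_right[symmetric] by linarith
    also have "\<dots> = 2 * K\<^sup>2 * N + 1 * (K * N)"
      by (simp add: power2_eq_square algebra_simps)
    also have "\<dots> < 2 * K\<^sup>2 * N + 2 * K * (K * N)"
      using \<open>0 < K\<close> KN by (intro add_strict_left_mono mult_strict_right_mono) auto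
    also have "\<dots> = 4 * K\<^sup>2 * N"
      by (simp add: power2_eq_square)
    finally show ?thesis
      using p by simp
  qed
  ultimately show False
    using cong unfolding cong_0_iff by (metis dvd_imp_le_int abs_of_nat not_le)
qed

section \<open>Independent sets of the Cayley graph\<close>

lemma Fp_minus_eq:
  assumes "1 < p"
  shows "v \<ominus>\<^bsub>Fp p\<^esub> u = (v - u) mod int p"
proof -
  interpret residues "int p" "Fp p"
    using assms by unfold_locales auto
  show ?thesis
    unfolding a_minus_def res_neg_eq res_add_eq by (simp add: mod_simps)
qed

lemma independent_in_Cay_iff:
  assumes "1 < p"
  shows "independent_in (with_proj (Cay p A)) S \<longleftrightarrow> S \<subseteq> {0..<int p} \<and>
    (\<forall>u\<in>S. \<forall>v\<in>S. u \<noteq> v \<longrightarrow> (v - u) mod int p \<notin> A)"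
proof -
  have verts: "carrier (Fp p) = {0..<int p}"
    by (auto simp: residue_ring_def)
  have sym: "(u, v) \<in> parcs (mk_symmetric (with_proj (Cay p A))) \<longleftrightarrow>
      (u, v) \<in> parcs (Cay p A) \<or> (v, u) \<in> parcs (Cay p A)" for u v
    by (auto simp: parcs_mk_symmetric Bex_def)
  have arc: "(u, v) \<in> parcs (Cay p A) \<longleftrightarrow>
      u \<in> {0..<int p} \<and> v \<in> {0..<int p} \<and> (v - u) mod int p \<in> A" for u v
    by (simp add: Cay_def verts Fp_minus_eq[OF assms])
  have pverts: "pverts (Cay p A) = {0..<int p}"
    by (simp add: Cay_def verts)
  \<comment> \<open>\<open>R u v\<close> stands for \<open>(v - u) mod int p \<in> A\<close>.
    Symmetrizing the arcs changes nothing, because \<open>u\<close> and \<open>v\<close> already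
    range over all ordered pairs from \<open>S\<close>.\<close>
  have iff: "S \<subseteq> V \<and> (\<forall>u\<in>S. \<forall>v\<in>S. u \<noteq> v \<longrightarrow>
        \<not> (u \<in> V \<and> v \<in> V \<and> R u v \<or> v \<in> V \<and> u \<in> V \<and> R v u)) \<longleftrightarrow>
      S \<subseteq> V \<and> (\<forall>u\<in>S. \<forall>v\<in>S. u \<noteq> v \<longrightarrow> \<not> R u v)" for V :: "int set" and R
    by (metis subsetD)
  show ?thesis
    unfolding independent_in_def with_proj_simps sym arc pverts by (rule iff)
qed

lemma alpha_Cay_le:
  assumes "1 < p"
    and "\<And>S. S \<subseteq> {0..<int p} \<Longrightarrow>
      \<forall>u\<in>S. \<forall>v\<in>S. u \<noteq> v \<longrightarrow> (v - u) mod int p \<notin> A \<Longrightarrow> card S \<le> b"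
  shows "alpha_Cay p A \<le> b"
proof -
  have le: "card S \<le> b" if "independent_in (with_proj (Cay p A)) S" for S
    using that assms by (auto simp: independent_in_Cay_iff)
  \<comment> \<open>The empty set is a witness that \<open>Max\<close> is taken over a nonempty
    collection.\<close>
  have "independent_in (with_proj (Cay p A)) {}"
    using assms(1) by (simp add: independent_in_Cay_iff)
  then have "{card S |S. independent_in (with_proj (Cay p A)) S} \<noteq> {}"
    by blast
  moreover have "finite {card S |S. independent_in (with_proj (Cay p A)) S}"
    by (rule finite_subset[of _ "{..b}"]) (auto dest: le)
  ultimately show ?thesis
    unfolding independence_number_def by (subst Max_le_iff) (auto dest: le)
qed

text \<open>The translates of an independent set \<open>S\<close> by \<open>- x 0\<close>, ...,
  \<open>- x n\<close> are pairwise disjoint in the field: a common element would give two members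
  of \<open>S\<close> whose difference is some \<open>x j - x i\<close> in \<open>A\<close>. Hence
  \<open>(n + 1) * card S \<le> p\<close>.\<close>

lemma alpha_Cay_clique_bound:
  fixes x :: "nat \<Rightarrow> int"
  assumes "1 < p" and x: "strict_mono_on {..n} x" "\<And>j. j \<le> n \<Longrightarrow> x j \<in> {0..<int p}"
    and A: "\<And>i j. i < j \<Longrightarrow> j \<le> n \<Longrightarrow> x j - x i \<in> A"
  shows "alpha_Cay p A \<le> p div (n + 1)"
proof (rule alpha_Cay_le[OF assms(1)])
  fix S
  assume S: "S \<subseteq> {0..<int p}"
    and indep: "\<forall>u\<in>S. \<forall>v\<in>S. u \<noteq> v \<longrightarrow> (v - u) mod int p \<notin> A"
  have less: False
    if "s \<in> S" "t \<in> S" "i < j" "j \<le> n" "(s - x j) mod int p = (t - x i) mod int p" for s t i j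
  proof -
    have lt: "x i < x j"
      using that by (intro strict_mono_onD[OF x(1)]) auto
    have range: "x i \<in> {0..<int p}" "x j \<in> {0..<int p}"
      using that by (intro x(2); simp)+
    have "[s - x j = t - x i] (mod int p)"
      using that by (simp add: cong_def)
    from cong_add[OF this cong_refl[of "x j - t"]] have "[s - t = x j - x i] (mod int p)"
      by simp
    \<comment> \<open>As \<open>x j - x i\<close> lies strictly between 0 and \<open>p\<close>, it
      is its own residue, so the hypothesis on \<open>A\<close> speaks of the arc from
      \<open>t\<close> to \<open>s\<close>.\<close>
    then have mod: "(s - t) mod int p = x j - x i"
      using lt range by (simp add: cong_def)
    have "s \<noteq> t"
      using mod lt by auto
    with mod A[OF that(3,4)] indep that(1,2) show False
      by metis
  qed
  \<comment> \<open>Injectivity on pairs expresses that the translates are disjoint and each has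
    \<open>card S\<close> elements.\<close>
  have "inj_on (\<lambda>(s, j). (s - x j) mod int p) (S \<times> {..n})"
  proof (rule inj_onI, clarsimp)
    fix s i t j
    assume *: "s \<in> S" "t \<in> S" "i \<le> n" "j \<le> n" "(s - x i) mod int p = (t - x j) mod int p"
    then have "i = j"
      using less[of s t j i] less[of t s i j] by (metis linorder_neqE_nat)
    with * have "[s - x i + x i = t - x i + x i] (mod int p)"
      by (intro cong_add) (simp_all add: cong_def)
    then have "s mod int p = t mod int p"
      by (simp add: cong_def)
    with * S \<open>i = j\<close> show "s = t \<and> i = j"
      by (metis atLeastLessThan_iff mod_pos_pos_trivial subsetD)
  qed
  moreover have "(\<lambda>(s, j). (s - x j) mod int p) ` (S \<times> {..n}) \<subseteq> {0..<int p}"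
    using assms(1) by auto
  ultimately have "card (S \<times> {..n}) \<le> card {0..<int p}"
    by (intro card_inj_on_le) auto
  then show "card S \<le> p div (n + 1)"
    by (simp add: card_cartesian_product less_eq_div_iff_mult_less_eq)
qed

lemma alpha_Cay_power_differences:
  assumes "1 < M" "M ^ n < int p" "power_differences M n \<subseteq> A"
  shows "alpha_Cay p A \<le> p div (n + 1)"
proof (rule alpha_Cay_clique_bound[of _ _ "\<lambda>j. M ^ j"])
  have "1 \<le> M ^ n"
    using assms(1) by simp
  then show "1 < p"
    using assms(2) by linarith
  show "strict_mono_on {..n} (\<lambda>j. M ^ j)"
    using assms(1) by (auto simp: strict_mono_on_def intro: power_strict_increasing)
  show "M ^ j \<in> {0..<int p}" if "j \<le> n" for j
  proof -
    have "M ^ j \<le> M ^ n"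
      using assms(1) that by (intro power_increasing) auto
    moreover have "0 < M ^ j"
      using assms(1) by simp
    ultimately show ?thesis
      using assms(2) by (simp add: less_imp_le)
  qed
  show "M ^ j - M ^ i \<in> A" if "i < j" "j \<le> n" for i j
    using that assms(3) by (auto simp: power_differences_def)
qed

section \<open>Choice of the parameters and the logarithmic bound\<close>

text \<open>The exponent is the integer part of the logarithm of \<open>N\<close> to base
  \<open>M\<close>: the predecessor of the first exponent whose power exceeds \<open>N\<close>. That
  first exponent is not 0 because \<open>M ^ 0 \<le> N\<close>.\<close>

lemma exists_power_bracket:
  fixes M N :: int
  assumes "1 < M" "1 \<le> N"
  obtains n where "M ^ n \<le> N" "N < M ^ (n + 1)"
proof -
  obtain n0 where "real_of_int N < real_of_int M ^ n0"
    using real_arch_pow[of "real_of_int M" "real_of_int N"] assms(1) by auto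
  then have ex: "N < M ^ n0"
    by (metis of_int_less_iff of_int_power)
  define m where "m = (LEAST m. N < M ^ m)"
  have m: "N < M ^ m"
    unfolding m_def using ex by (rule LeastI)
  with assms(2) have "m \<noteq> 0"
    by (cases m) auto
  then obtain n where "m = Suc n"
    by (cases m) auto
  with m have "M ^ n \<le> N" "N < M ^ (n + 1)"
    using not_less_Least[of n "\<lambda>m. N < M ^ m"] by (auto simp: m_def)
  then show ?thesis
    by (rule that)
qed

text \<open>Write \<open>Q = 4 * K\<^sup>2\<close>. The interval alone has at least
  \<open>p / Q\<close> elements. The clique size \<open>n + 1\<close> satisfies
  \<open>p \<le> Q * (K + 1) ^ (n + 1)\<close>. The hypothesis on \<open>p\<close> makes
  \<open>ln Q\<close> at most half of \<open>ln p\<close>, which accounts for the factor 2 in the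
  last bound.\<close>

lemma solution_free_small_alpha:
  assumes "1 \<le> k" "nondegenerate k c"
    and K: "K = (\<Sum>i\<in>{1..k}. \<bar>c i\<bar>)" "0 < K"
    and p: "(4 * K\<^sup>2)\<^sup>2 < int p"
  shows "\<exists>A. A \<subseteq> carrier (Fp p) \<and> solution_free k c p A \<and>
    real (card A) \<ge> 1 / (4 * real_of_int K ^ 2) * real p \<and>
    real (alpha_Cay p A) \<le> 2 * ln (real_of_int (K + 1)) * (real p / ln (real p))"
proof -
  define Q where "Q = 4 * K\<^sup>2"
  define N where "N = int p div Q"
  have "1 * 1 \<le> K * K"
    using K(2) by (intro mult_mono) auto
  then have Q: "4 \<le> Q"
    by (simp add: Q_def power2_eq_square)
  then have "4 * Q \<le> Q\<^sup>2"
    by (simp add: power2_eq_square)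
  with p Q have pQ: "Q \<le> int p" "16 < p" "Q\<^sup>2 \<le> int p"
    by (auto simp: Q_def)
  have N: "1 \<le> N" "Q * N \<le> int p" "int p < Q * (N + 1)"
  proof -
    have "Q * N + int p mod Q = int p"
      by (simp add: N_def)
    moreover have "0 \<le> int p mod Q" "int p mod Q < Q"
      using Q by auto
    ultimately show "Q * N \<le> int p" "int p < Q * (N + 1)"
      by (auto simp: algebra_simps)
    show "1 \<le> N"
      using Q pQ by (simp add: N_def pos_imp_zdiv_pos_iff int_one_le_iff_zero_less)
  qed
  obtain n where n: "(K + 1) ^ n \<le> N" "N < (K + 1) ^ (n + 1)"
    using exists_power_bracket[of "K + 1" N] K(2) N(1) by auto
  define A where "A = interval_part K N \<union> power_differences (K + 1) n"
  \<comment> \<open>The right end of the interval stays below \<open>p\<close>, since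
    \<open>2 * K + 1 \<le> 3 * K\<^sup>2 < Q\<close>.\<close>
  have top: "2 * K * N + N < int p"
  proof -
    have "1 * K \<le> K * K"
      using K(2) by (intro mult_right_mono) auto
    then have "2 * K + 1 < Q"
      using \<open>1 * 1 \<le> K * K\<close> by (simp add: Q_def power2_eq_square)
    then have "(2 * K + 1) * N < Q * N"
      using N(1) by (intro mult_strict_right_mono) auto
    then show ?thesis
      using N(2) by (simp add: algebra_simps)
  qed
  have "0 \<le> K * N"
    using K(2) N(1) by simp
  with top have "N < int p"
    by linarith
  have "A \<subseteq> carrier (Fp p)"
  proof
    fix x
    assume "x \<in> A"
    then have "0 \<le> x \<and> x < int p"
    proof (unfold A_def, elim UnE)
      assume "x \<in> power_differences (K + 1) n"
      then have "0 < x" "x \<le> (K + 1) ^ n"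
        using K(2) by (auto dest: power_differences_bounds[rotated])
      then show ?thesis
        using n(1) \<open>N < int p\<close> by linarith
    next
      assume "x \<in> interval_part K N"
      then show ?thesis
        using top \<open>0 \<le> K * N\<close> by (simp add: interval_part_def)
    qed
    then show "x \<in> carrier (Fp p)"
      by (simp add: residue_ring_def)
  qed
  moreover have "solution_free k c p A"
    unfolding A_def using assms N n Q_def by (intro solution_free_interval_power_differences) auto
  moreover have "real (card A) \<ge> 1 / (4 * real_of_int K ^ 2) * real p"
  proof -
    have fin: "finite A"
      using \<open>A \<subseteq> carrier (Fp p)\<close> by (rule finite_subset) (simp add: residue_ring_def)
    \<comment> \<open>The interval is closed. Its extra point makes up for the rounding in
      \<open>N\<close>: \<open>Q * (N + 1)\<close> exceeds \<open>p\<close>, whereas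
      \<open>Q * N\<close> may fall short of it.\<close>
    have "int (card (interval_part K N)) = N + 1"
      using N(1) by (simp add: interval_part_def)
    moreover have "card (interval_part K N) \<le> card A"
      using fin by (intro card_mono) (auto simp: A_def)
    ultimately have "N + 1 \<le> int (card A)"
      by linarith
    then have "Q * (N + 1) \<le> Q * int (card A)"
      using Q by (intro mult_left_mono) auto
    with N(3) have "real_of_int (int p) \<le> real_of_int (Q * int (card A))"
      by (intro of_int_le_iff[THEN iffD2]) linarith
    then show ?thesis
      using K(2) by (simp add: Q_def field_simps)
  qed
  moreover have "real (alpha_Cay p A) \<le> 2 * ln (real_of_int (K + 1)) * (real p / ln (real p))"
  proof -
    define L where "L = ln (real_of_int (K + 1))"
    have L: "0 < L" "0 < ln (real p)"
      using K(2) pQ(2) by (auto simp: L_def)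
    have "alpha_Cay p A \<le> p div (n + 1)"
      using n(1) \<open>N < int p\<close> K(2)
      by (intro alpha_Cay_power_differences[of "K + 1"]) (auto simp: A_def)
    then have "real (alpha_Cay p A) \<le> real (p div (n + 1))"
      by (rule of_nat_mono)
    also have "\<dots> \<le> real p / real (n + 1)"
    proof -
      have "real (p div (n + 1) * (n + 1)) \<le> real p"
        by (intro of_nat_mono div_times_less_eq_dividend)
      then show ?thesis
        by (simp only: of_nat_mult pos_le_divide_eq of_nat_0_less_iff)
    qed
    finally have alpha: "real (alpha_Cay p A) \<le> real p / real (n + 1)" .
    \<comment> \<open>For integers, \<open>N < (K + 1) ^ (n + 1)\<close> gives
      \<open>N + 1 \<le> (K + 1) ^ (n + 1)\<close>.\<close>
    have "int p \<le> Q * (K + 1) ^ (n + 1)"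
      using N(3) n(2) Q mult_left_mono[of "N + 1" "(K + 1) ^ (n + 1)" Q] by linarith
    then have "real_of_int (int p) \<le> real_of_int (Q * (K + 1) ^ (n + 1))"
      by (rule of_int_le_iff[THEN iffD2])
    then have "ln (real p) \<le> ln (real_of_int Q * real_of_int (K + 1) ^ (n + 1))"
      using pQ(2) by (subst ln_le_cancel_iff) auto
    also have "\<dots> = ln (real_of_int Q) + real (n + 1) * L"
      using Q K(2) by (subst ln_mult) (auto simp: L_def ln_realpow simp del: power_Suc)
    \<comment> \<open>Half of \<open>ln p\<close> absorbs the constant \<open>ln Q\<close>; the
      other half is left as a lower bound for \<open>(n + 1) * L\<close>.\<close>
    also have "ln (real_of_int Q) \<le> ln (real p) / 2"
    proof -
      have "real_of_int (Q\<^sup>2) \<le> real_of_int (int p)"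
        using pQ(3) by (rule of_int_le_iff[THEN iffD2])
      then have "ln (real_of_int Q ^ 2) \<le> ln (real p)"
        using Q pQ(2) by (subst ln_le_cancel_iff) auto
      then show ?thesis
        using Q by (simp add: ln_realpow)
    qed
    finally have "ln (real p) \<le> 2 * L * real (n + 1)"
      by (simp add: algebra_simps)
    then have "real p / real (n + 1) \<le> 2 * L * (real p / ln (real p))"
      using L mult_left_mono[of "ln (real p)" "2 * L * real (n + 1)" "real p"]
      by (simp add: field_simps)
    with alpha show ?thesis
      unfolding L_def by linarith
  qed
  ultimately show ?thesis
    by blast
qed

section \<open>Passage to the limiting density\<close>

text \<open>The sizes are bounded by the size of the field, so the \<open>Sup\<close> in
  \<open>D\<close> is a genuine upper bound.\<close>

lemma card_le_D:
  assumes "A \<subseteq> carrier (Fp p)" "solution_free k c p A" "real (alpha_Cay p A) \<le> \<epsilon> * real p"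
  shows "card A \<le> D k c \<epsilon> p"
  unfolding D_def
proof (rule cSup_upper)
  show "card A \<in> {card A |A. A \<subseteq> carrier (Fp p) \<and> solution_free k c p A \<and>
      real (alpha_Cay p A) \<le> \<epsilon> * real p}"
    using assms by (intro CollectI exI[of _ A] conjI refl)
  have "card B \<le> card (carrier (Fp p))" if "B \<subseteq> carrier (Fp p)" for B
    using that by (intro card_mono) (auto simp: residue_ring_def)
  then show "bdd_above {card A |A. A \<subseteq> carrier (Fp p) \<and> solution_free k c p A \<and>
      real (alpha_Cay p A) \<le> \<epsilon> * real p}"
    by (intro bdd_aboveI) blast
qed

text \<open>Once \<open>ln p\<close> reaches \<open>C / \<epsilon>\<close>, the given sets are
  admissible for \<open>D\<close>. The lower bound \<beta> then holds at all large primes, so it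
  bounds the lower limit, which is at most the upper limit because the filter is proper.\<close>

lemma d_ge:
  fixes p\<^sub>0 :: nat
  assumes "0 < \<epsilon>"
    and sets: "\<And>p. prime p \<Longrightarrow> p\<^sub>0 < p \<Longrightarrow>
      \<exists>A. A \<subseteq> carrier (Fp p) \<and> solution_free k c p A \<and> real (card A) \<ge> \<beta> * real p \<and>
        real (alpha_Cay p A) \<le> C * (real p / ln (real p))"
  shows "d k c \<epsilon> \<ge> ereal \<beta>"
proof -
  define F where "F = inf at_top (principal {p :: nat. prime p})"
  \<comment> \<open>This is the infinitude of primes, phrased for filters.\<close>
  have "F \<noteq> bot"
  proof
    assume "F = bot"
    then have "eventually (\<lambda>p::nat. \<not> prime p) at_top"
      by (simp add: F_def trivial_limit_def eventually_inf_principal)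
    then obtain n :: nat where "\<And>p. n \<le> p \<Longrightarrow> \<not> prime p"
      by (auto simp: eventually_at_top_linorder)
    then show False
      using bigger_prime[of n] by (auto dest: less_imp_le)
  qed
  have "filterlim (\<lambda>p::nat. ln (real p)) at_top at_top"
    by (rule filterlim_compose[OF ln_at_top filterlim_real_sequentially])
  then have "eventually (\<lambda>p::nat. C / \<epsilon> \<le> ln (real p)) at_top"
    by (simp add: filterlim_at_top)
  moreover have "eventually (\<lambda>p::nat. p\<^sub>0 < p) at_top"
    by (rule eventually_gt_at_top)
  ultimately have "eventually (\<lambda>p. ereal \<beta> \<le> ereal (real (D k c \<epsilon> p) / real p)) F"
    unfolding F_def eventually_inf_principal
  proof eventually_elim
    case (elim p)
    show ?case
    proof
      assume "p \<in> {p. prime p}"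
      then have "prime p"
        by simp
      then have p: "1 < p"
        by (rule prime_gt_1_nat)
      then have ln: "0 < ln (real p)"
        by simp
      obtain A where A: "A \<subseteq> carrier (Fp p)" "solution_free k c p A" "real (card A) \<ge> \<beta> * real p"
        "real (alpha_Cay p A) \<le> C * (real p / ln (real p))"
        using sets[OF \<open>prime p\<close> elim(2)] by blast
      have "C \<le> \<epsilon> * ln (real p)"
        using elim(1) assms(1) by (simp add: field_simps)
      then have "C * (real p / ln (real p)) \<le> \<epsilon> * real p"
        using ln mult_right_mono[of C "\<epsilon> * ln (real p)" "real p"] by (simp add: field_simps)
      with A have "card A \<le> D k c \<epsilon> p"
        by (intro card_le_D) auto
      with A(3) have "\<beta> * real p \<le> real (D k c \<epsilon> p)"
        by linarith
      with p show "ereal \<beta> \<le> ereal (real (D k c \<epsilon> p) / real p)"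
        by (simp add: field_simps)
    qed
  qed
  then have "ereal \<beta> \<le> Liminf F (\<lambda>p. ereal (real (D k c \<epsilon> p) / real p))"
    by (rule Liminf_bounded)
  also have "\<dots> \<le> Limsup F (\<lambda>p. ereal (real (D k c \<epsilon> p) / real p))"
    using \<open>F \<noteq> bot\<close> by (rule Liminf_le_Limsup)
  finally show ?thesis
    by (simp add: d_def F_def)
qed

theorem theorem3p3:
  fixes k :: nat and c :: "nat \<Rightarrow> int"
  assumes "k \<ge> 3"
    and "\<And>i. i \<in> {1..k} \<Longrightarrow> c i \<noteq> 0"
    and "nondegenerate k c"
  shows "\<exists>(\<beta>::real) (p\<^sub>0::nat) (C::real). \<beta> > 0 \<and> p\<^sub>0 > 0 \<and> C > 0 \<and>
    (\<forall>p::nat. prime p \<and> p > p\<^sub>0 \<longrightarrow>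
      (\<exists>A. A \<subseteq> carrier (Fp p) \<and> solution_free k c p A \<and>
        real (card A) \<ge> \<beta> * real p \<and>
        real (alpha_Cay p A) \<le> C * (real p / ln (real p)))) \<and>
    (\<forall>\<epsilon>::real. \<epsilon> > 0 \<longrightarrow> d k c \<epsilon> \<ge> ereal \<beta>)"
proof -
  define K where "K = (\<Sum>i\<in>{1..k}. \<bar>c i\<bar>)"
  \<comment> \<open>A single nonzero coefficient already makes \<open>K\<close> positive.\<close>
  have "0 < \<bar>c 1\<bar>" "\<bar>c 1\<bar> \<le> K"
    using assms(1,2) unfolding K_def by (auto intro!: member_le_sum)
  then have K: "0 < K"
    by linarith
  define \<beta> where "\<beta> = 1 / (4 * real_of_int K ^ 2)"
  define C where "C = 2 * ln (real_of_int (K + 1))"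
  \<comment> \<open>The threshold is the square of \<open>4 * K\<^sup>2\<close>, the reciprocal of
    \<beta>.\<close>
  define p\<^sub>0 where "p\<^sub>0 = nat ((4 * K\<^sup>2)\<^sup>2)"
  have sets: "\<exists>A. A \<subseteq> carrier (Fp p) \<and> solution_free k c p A \<and> real (card A) \<ge> \<beta> * real p \<and>
      real (alpha_Cay p A) \<le> C * (real p / ln (real p))" if "p\<^sub>0 < p" for p
    unfolding \<beta>_def C_def using that assms K
    by (intro solution_free_small_alpha) (auto simp: K_def p\<^sub>0_def)
  have "0 < \<beta>" "0 < p\<^sub>0" "0 < C"
    using K by (auto simp: \<beta>_def p\<^sub>0_def C_def)
  moreover have "d k c \<epsilon> \<ge> ereal \<beta>" if "0 < \<epsilon>" for \<epsilon>
    using that sets by (rule d_ge)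
  ultimately show ?thesis
    using sets by (intro exI[of _ \<beta>] exI[of _ p\<^sub>0] exI[of _ C]) simp
qed

end
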